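(* (i) Let $d \leq 2$ be an integer. Then every $d$-collapsible face $\sigma$ of a $d$-collapsible complex $K$ is good, i.e. the complex $K_\sigma$ is again $d$-collapsible. (ii) Let $d \geq 3$ be an integer. Then there exists a $d$-collapsible complex $K$ containing a bad $d$-collapsible face, i.e. a $d$-collapsible face $\sigma$ such that $K_\sigma$ is not $d$-collapsible.
   Context: All simplicial complexes are finite abstract simplicial complexes: set systems $K$ of finite sets such that $A \in K$ and $B \subseteq A$ imply $B \in K$. Elements of $K$ are faces; $\dim \sigma = |\sigma|-1$; the empty set is a face (of dimension $-1$) of every complex having at least one face. "Maximal face" means inclusionwise-maximal face. The empty complex $\emptyset$ has no faces at all (not even the empty face). A face $\sigma$ of $K$ is collapsible if there is a unique maximal face of $K$ containing $\sigma$; this maximal face is denoted $\tau(\sigma)$ ($\tau(\sigma)=\sigma$ is allowed). If moreover $\dim\sigma \leq d-1$, then $\sigma$ is a $d$-collapsible face of $K$. Write $[\sigma,\tau(\sigma)] = \{\eta \in K : \sigma \subseteq \eta \subseteq \tau(\sigma)\}$. For a $d$-collapsible face $\sigma$, the complex $K_\sigma = K \setminus [\sigma,\tau(\sigma)]$ is said to arise from $K$ by an elementary $d$-collapse. The complex $K$ $d$-collapses to $L$ if $L$ is obtained from $K$ by a finite sequence of elementary $d$-collapses. The complex $K$ is $d$-collapsible if it $d$-collapses to the empty complex $\emptyset$. *)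

theory Defs
  imports Main
begin

text \<open>
  Finite abstract simplicial complexes. No nonemptiness is required: the empty complex
  \<open>{}\<close> (no faces at all) and the complex \<open>{{}}\<close> (only the empty face) are distinct.
\<close>

definition simplicial_complex :: "'a set set \<Rightarrow> bool" where
  "simplicial_complex K \<longleftrightarrow>
     finite K \<and> (\<forall>A\<in>K. finite A) \<and> (\<forall>A\<in>K. \<forall>B. B \<subseteq> A \<longrightarrow> B \<in> K)"

text \<open>Integer valued, since the empty face has dimension \<open>-1\<close>.\<close>

definition dim_face :: "'a set \<Rightarrow> int" where
  "dim_face \<sigma> = int (card \<sigma>) - 1"

definition maximal_face :: "'a set set \<Rightarrow> 'a set \<Rightarrow> bool" where
  "maximal_face K \<tau> \<longleftrightarrow> \<tau> \<in> K \<and> (\<forall>\<eta>\<in>K. \<tau> \<subseteq> \<eta> \<longrightarrow> \<eta> = \<tau>)"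

definition collapsible_face :: "'a set set \<Rightarrow> 'a set \<Rightarrow> bool" where
  "collapsible_face K \<sigma> \<longleftrightarrow> \<sigma> \<in> K \<and> (\<exists>!\<tau>. maximal_face K \<tau> \<and> \<sigma> \<subseteq> \<tau>)"

text \<open>The face \<open>\<tau>(\<sigma>)\<close>; only meaningful if \<open>\<sigma>\<close> is a collapsible face of \<open>K\<close>.\<close>

definition tau :: "'a set set \<Rightarrow> 'a set \<Rightarrow> 'a set" where
  "tau K \<sigma> = (THE \<tau>. maximal_face K \<tau> \<and> \<sigma> \<subseteq> \<tau>)"

definition d_collapsible_face :: "int \<Rightarrow> 'a set set \<Rightarrow> 'a set \<Rightarrow> bool" where
  "d_collapsible_face d K \<sigma> \<longleftrightarrow> collapsible_face K \<sigma> \<and> dim_face \<sigma> \<le> d - 1"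

definition face_interval :: "'a set set \<Rightarrow> 'a set \<Rightarrow> 'a set \<Rightarrow> 'a set set" where
  "face_interval K \<sigma> \<tau> = {\<eta> \<in> K. \<sigma> \<subseteq> \<eta> \<and> \<eta> \<subseteq> \<tau>}"

text \<open>The complex \<open>K\<^sub>\<sigma>\<close>.\<close>

definition collapse_at :: "'a set set \<Rightarrow> 'a set \<Rightarrow> 'a set set" where
  "collapse_at K \<sigma> = K - face_interval K \<sigma> (tau K \<sigma>)"

definition elementary_d_collapse :: "int \<Rightarrow> 'a set set \<Rightarrow> 'a set set \<Rightarrow> bool" where
  "elementary_d_collapse d K L \<longleftrightarrow> (\<exists>\<sigma>. d_collapsible_face d K \<sigma> \<and> L = collapse_at K \<sigma>)"

definition d_collapses_to :: "int \<Rightarrow> 'a set set \<Rightarrow> 'a set set \<Rightarrow> bool" where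
  "d_collapses_to d K L \<longleftrightarrow> (elementary_d_collapse d)\<^sup>*\<^sup>* K L"

definition d_collapsible :: "int \<Rightarrow> 'a set set \<Rightarrow> bool" where
  "d_collapsible d K \<longleftrightarrow> d_collapses_to d K {}"

text \<open>Good and bad faces are only considered among the \<open>d\<close>-collapsible faces.\<close>

definition good_face :: "int \<Rightarrow> 'a set set \<Rightarrow> 'a set \<Rightarrow> bool" where
  "good_face d K \<sigma> \<longleftrightarrow> d_collapsible_face d K \<sigma> \<and> d_collapsible d (collapse_at K \<sigma>)"

definition bad_face :: "int \<Rightarrow> 'a set set \<Rightarrow> 'a set \<Rightarrow> bool" where
  "bad_face d K \<sigma> \<longleftrightarrow> d_collapsible_face d K \<sigma> \<and> \<not> d_collapsible d (collapse_at K \<sigma>)"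

end

theory Submission
  imports Defs
begin

text \<open>
  A face \<open>s\<close> is collapsible exactly if one face \<open>t\<close> contains all faces above \<open>s\<close>, and collapsing
  it deletes all faces above \<open>s\<close>. Collapses made one after the other therefore delete the faces
  above some member of a growing set \<open>E\<close>, whatever the order; only the question whether each of
  them is permitted depends on the order.

  \<^bold>\<open>Dimension at most two.\<close> By induction on the number of faces it suffices to transfer
  collapsibility from \<open>K\<close> minus \<open>s1\<close>, the first step of a given collapsing sequence, to \<open>K\<close> minus
  \<open>s\<close>, where \<open>s\<close> is an arbitrary \<open>d\<close>-collapsible face (\<open>first_collapse_transfers\<close>). Whenever both
  faces stay collapsible after the other one has been collapsed, the two collapses commute and the
  induction hypothesis closes the diamond. This settles the case of different maximal faces, and
  the case of a common maximal face \<open>t\<close> when \<open>s1\<close> and \<open>s\<close> differ from their intersection by at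
  most one vertex each, or are joined by a chain of such pairs. Such a chain exists as soon as the
  empty face or a vertex of \<open>t\<close> is collapsible. Since the faces have at most two vertices, what
  remains are two disjoint edges \<open>s1\<close> and \<open>s\<close> of \<open>t\<close>. Suppose \<open>s\<close> were bad. Every good
  edge of \<open>t\<close> is then disjoint from \<open>s\<close>, as good edges transfer goodness to the collapsible edges
  that they meet. Collapse as many good edges of \<open>t\<close> as possible while keeping the complex
  \<open>d\<close>-collapsible, and look at the next collapse. If it happened outside \<open>t\<close>, it could be moved to
  the front of the sequence, where it commutes with \<open>s\<close>. If it happened inside \<open>t\<close>, it would be
  one more good edge. Either way this is a contradiction.

  \<^bold>\<open>Dimension at least three.\<close> A bad face occurs on any path of collapses that leads from a
  collapsible complex to one that is not collapsible. So it is enough to exhibit a trap: a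
  collapsible complex \<open>K\<close> of dimension at most \<open>d + 1\<close> that also collapses to a complex \<open>L\<close> of dimension \<open>d\<close> with a set of
  \<open>d\<close>-faces in which each facet of a member lies in a second member. Such a set never starts to
  collapse. Suspension turns a trap for \<open>d\<close> into one for \<open>d + 1\<close> (\<open>greedy_trap_suspension\<close>), which
  leaves \<open>d = 3\<close>.

  There \<open>K\<close> consists of a 4-simplex with vertices 0, ..., 4 and 24 tetrahedra around it
  (\<open>outer_tetrahedra\<close>); the triangles 012, 123 and 034 lie in the simplex only. Collapsing 012 and
  then 123 leaves the tetrahedra 0134 and 0234 of the simplex. The triangle 124 is then contained
  in a single tetrahedron, an outer one, and all tetrahedra unravel from there. Collapsing 034
  instead leaves 0123, 0124 and 1234. They have 124 in common with that outer tetrahedron, and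
  together with the outer tetrahedra they cover every triangle in their boundaries at least twice.
\<close>

section \<open>Collapses as deletions\<close>

text \<open>
  The face \<open>t\<close> is then the unique maximal face above \<open>s\<close>.
\<close>

definition free_face :: "'a set set \<Rightarrow> 'a set \<Rightarrow> 'a set \<Rightarrow> bool" where
  "free_face K s t \<longleftrightarrow> t \<in> K \<and> s \<subseteq> t \<and> (\<forall>x\<in>K. s \<subseteq> x \<longrightarrow> x \<subseteq> t)"

lemma free_faceD:
  assumes "free_face K s t"
  shows "t \<in> K" "s \<subseteq> t" "\<And>x. x \<in> K \<Longrightarrow> s \<subseteq> x \<Longrightarrow> x \<subseteq> t"
  using assms unfolding free_face_def by (simp, simp, blast)

lemma free_faceI:
  assumes "t \<in> K" "s \<subseteq> t" "\<And>x. x \<in> K \<Longrightarrow> s \<subseteq> x \<Longrightarrow> x \<subseteq> t"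
  shows "free_face K s t"
  unfolding free_face_def by (intro conjI ballI impI assms)

definition deletion :: "'a set set \<Rightarrow> 'a set set \<Rightarrow> 'a set set" where
  "deletion K E = {x \<in> K. \<forall>e\<in>E. \<not> e \<subseteq> x}"

lemma mem_deletion: "x \<in> deletion K E \<longleftrightarrow> x \<in> K \<and> (\<forall>e\<in>E. \<not> e \<subseteq> x)"
  by (simp add: deletion_def)

text \<open>
  Collapses made in succession depend only on the set of collapsed faces, not on their order. All
  commutation arguments below rest on this.
\<close>

lemma deletion_deletion: "deletion (deletion K E) {s} = deletion K (insert s E)"
  by (auto simp: deletion_def)

lemma simplicial_complex_deletion:
  assumes "simplicial_complex K" shows "simplicial_complex (deletion K E)"
proof -
  have "finite (deletion K E)" using assms unfolding simplicial_complex_def deletion_def by simp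
  moreover have "B \<in> deletion K E" if "A \<in> deletion K E" "B \<subseteq> A" for A B
    using that assms unfolding simplicial_complex_def deletion_def by blast
  moreover have "finite A" if "A \<in> deletion K E" for A
    using that assms unfolding simplicial_complex_def deletion_def by simp
  ultimately show ?thesis unfolding simplicial_complex_def by blast
qed

lemma simplicial_complex_subset:
  "simplicial_complex K \<Longrightarrow> A \<in> K \<Longrightarrow> B \<subseteq> A \<Longrightarrow> B \<in> K"
  unfolding simplicial_complex_def by blast

lemma simplicial_complex_finite_face:
  "simplicial_complex K \<Longrightarrow> A \<in> K \<Longrightarrow> finite A"
  unfolding simplicial_complex_def by blast

lemma free_face_finite:
  "simplicial_complex K \<Longrightarrow> free_face K s t \<Longrightarrow> finite s"
  using simplicial_complex_finite_face free_faceD(1,2) finite_subset by metis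

lemma free_face_in: "simplicial_complex K \<Longrightarrow> free_face K s t \<Longrightarrow> r \<subseteq> t \<Longrightarrow> r \<in> K"
  using simplicial_complex_subset free_faceD(1) by metis

lemma card_deletion_less:
  assumes "simplicial_complex K" "free_face K s t"
  shows "card (deletion K {s}) < card K"
proof -
  have "t \<in> K" "t \<notin> deletion K {s}" "deletion K {s} \<subseteq> K"
    using assms by (auto simp: free_face_def deletion_def)
  then have "deletion K {s} \<subset> K" by blast
  moreover have "finite K" using assms(1) by (simp add: simplicial_complex_def)
  ultimately show ?thesis by (rule psubset_card_mono[rotated])
qed

lemma maximal_face_eq: "maximal_face K m \<Longrightarrow> t \<in> K \<Longrightarrow> m \<subseteq> t \<Longrightarrow> m = t"
  unfolding maximal_face_def by metis

lemma maximal_face_mem: "maximal_face K m \<Longrightarrow> m \<in> K"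
  unfolding maximal_face_def by (rule conjunct1)

lemma maximal_face_above:
  assumes "finite K" "x \<in> K"
  obtains m where "maximal_face K m" "x \<subseteq> m"
proof -
  from finite_has_maximal2[OF assms] obtain m
    where m: "m \<in> K" "x \<subseteq> m" "\<forall>b\<in>K. m \<subseteq> b \<longrightarrow> m = b" by (elim bexE conjE)
  show ?thesis by (rule that[of m]) (use m in \<open>auto simp: maximal_face_def\<close>)
qed

text \<open>
  In a finite complex each face above \<open>s\<close> extends to a maximal one, so that a unique maximal face
  above \<open>s\<close> contains every face above \<open>s\<close>.
\<close>

lemma collapsible_face_iff_free:
  assumes "simplicial_complex K"
  shows "collapsible_face K s \<longleftrightarrow> (\<exists>t. free_face K s t)"
proof
  assume "collapsible_face K s"
  then obtain t where t: "maximal_face K t" "s \<subseteq> t"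
    and uniq: "\<And>m. maximal_face K m \<Longrightarrow> s \<subseteq> m \<Longrightarrow> m = t"
    unfolding collapsible_face_def by auto
  have "x \<subseteq> t" if x: "x \<in> K" "s \<subseteq> x" for x
  proof -
    have "finite K" using assms by (simp add: simplicial_complex_def)
    then obtain m where m: "maximal_face K m" "x \<subseteq> m" using x(1) by (rule maximal_face_above)
    then have "m = t" using uniq x(2) by simp
    then show ?thesis using m by simp
  qed
  then have "free_face K s t" using t by (simp add: free_face_def maximal_face_def)
  then show "\<exists>t. free_face K s t" ..
next
  assume "\<exists>t. free_face K s t"
  then obtain t where "free_face K s t" ..
  note t = free_faceD[OF this]
  have "maximal_face K t" unfolding maximal_face_def
  proof (intro conjI ballI impI)
    show "\<eta> = t" if "\<eta> \<in> K" "t \<subseteq> \<eta>" for \<eta>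
      using t(3)[OF that(1) order_trans[OF t(2) that(2)]] that(2) by (rule subset_antisym)
  qed (rule t(1))
  moreover have "m = t" if "maximal_face K m" "s \<subseteq> m" for m
    using maximal_face_eq[OF that(1) t(1)] t(3)[OF maximal_face_mem[OF that(1)] that(2)] .
  moreover have "s \<in> K" by (rule simplicial_complex_subset[OF assms t(1,2)])
  ultimately show "collapsible_face K s" using t(2) unfolding collapsible_face_def by metis
qed

lemma tau_free:
  assumes "free_face K s t" shows "tau K s = t"
  unfolding tau_def
proof (rule the_equality)
  show "maximal_face K t \<and> s \<subseteq> t" using assms unfolding free_face_def maximal_face_def by blast
  show "m = t" if "maximal_face K m \<and> s \<subseteq> m" for m
  proof -
    have "m \<subseteq> t" using that assms maximal_face_mem by (metis free_face_def)
    moreover have "t \<in> K" using assms by (simp add: free_face_def)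
    ultimately show ?thesis using that maximal_face_eq by blast
  qed
qed

lemma collapse_at_free:
  assumes "free_face K s t" shows "collapse_at K s = deletion K {s}"
proof -
  have "s \<subseteq> x \<and> x \<subseteq> t \<longleftrightarrow> s \<subseteq> x" if "x \<in> K" for x
    using assms that by (auto simp: free_face_def)
  then show ?thesis
    unfolding collapse_at_def face_interval_def tau_free[OF assms] deletion_def by auto
qed

lemma elementary_d_collapse_iff:
  assumes "simplicial_complex K"
  shows "elementary_d_collapse d K L \<longleftrightarrow>
    (\<exists>s t. free_face K s t \<and> int (card s) \<le> d \<and> L = deletion K {s})"
proof -
  have "d_collapsible_face d K s \<longleftrightarrow> (\<exists>t. free_face K s t) \<and> int (card s) \<le> d" for s
    unfolding d_collapsible_face_def dim_face_def collapsible_face_iff_free[OF assms]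
    by (intro conj_cong refl) linarith
  then have "elementary_d_collapse d K L \<longleftrightarrow>
    (\<exists>s. (\<exists>t. free_face K s t) \<and> int (card s) \<le> d \<and> L = collapse_at K s)"
    unfolding elementary_d_collapse_def by simp
  also have "\<dots> \<longleftrightarrow> (\<exists>s t. free_face K s t \<and> int (card s) \<le> d \<and> L = deletion K {s})"
    using collapse_at_free by fast
  finally show ?thesis .
qed

lemma d_collapsible_empty: "d_collapsible d {}"
  by (simp add: d_collapsible_def d_collapses_to_def)

lemma d_collapsible_step:
  assumes "simplicial_complex K" "free_face K s t" "int (card s) \<le> d"
    and "d_collapsible d (deletion K {s})"
  shows "d_collapsible d K"
proof -
  have "elementary_d_collapse d K (deletion K {s})"
    using assms elementary_d_collapse_iff by blast
  then show ?thesis using assms(4) unfolding d_collapsible_def d_collapses_to_def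
    by (rule converse_rtranclp_into_rtranclp)
qed

lemma d_collapsible_cases:
  assumes "simplicial_complex K" "d_collapsible d K"
  obtains "K = {}"
  | s t where "free_face K s t" "int (card s) \<le> d" "d_collapsible d (deletion K {s})"
proof -
  have "(elementary_d_collapse d)\<^sup>*\<^sup>* K {}"
    using assms(2) by (simp add: d_collapsible_def d_collapses_to_def)
  then show ?thesis
  proof (cases rule: converse_rtranclpE)
    case base
    then show ?thesis by (rule that(1))
  next
    case (step L)
    then obtain s t where "free_face K s t" "int (card s) \<le> d" "L = deletion K {s}"
      using elementary_d_collapse_iff[OF assms(1)] by metis
    with step(2) show ?thesis by (intro that(2)) (simp_all add: d_collapsible_def d_collapses_to_def)
  qed
qed

lemma free_face_deletion:
  assumes "free_face K s t" "\<And>e. e \<in> E \<Longrightarrow> \<not> e \<subseteq> t"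
  shows "free_face (deletion K E) s t"
  using assms unfolding free_face_def deletion_def by blast

lemma free_face_mono:
  assumes "free_face K s t" "s \<subseteq> r" "r \<subseteq> t"
  shows "free_face K r t"
  using assms unfolding free_face_def by blast

text \<open>
  If \<open>f\<close> has the single vertex \<open>v\<close> outside \<open>g\<close>, then a face above \<open>g\<close> survives the collapse of \<open>f\<close> iff
  it avoids \<open>v\<close>; hence \<open>t - {v}\<close> is the largest one. With two or more such vertices there would be
  several maximal faces above \<open>g\<close>.
\<close>

lemma free_face_deletion_neighbour:
  assumes K: "simplicial_complex K" and f: "free_face K f t" and g: "free_face K g t"
    and "card (f - g) \<le> 1" "\<not> f \<subseteq> g"
  shows "free_face (deletion K {f}) g (t - (f - g))"
proof -
  have "finite f" using K f by (rule free_face_finite)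
  moreover have "card (f - g) \<noteq> 0" using \<open>finite f\<close> \<open>\<not> f \<subseteq> g\<close> by auto
  ultimately obtain v where v: "f - g = {v}"
    using \<open>card (f - g) \<le> 1\<close> by (metis One_nat_def card_1_singletonE le_SucE le_zero_eq)
  have "t - {v} \<in> K" by (rule simplicial_complex_subset[OF K free_faceD(1)[OF f] Diff_subset])
  moreover have "x \<subseteq> t - {v}" if "x \<in> K" "g \<subseteq> x" "\<not> f \<subseteq> x" for x
  proof -
    have "x \<subseteq> t" using free_faceD(3)[OF g that(1,2)] .
    moreover have "v \<notin> x" using v that(2,3) by auto
    ultimately show ?thesis by auto
  qed
  moreover have "g \<subseteq> t - {v}" "\<not> f \<subseteq> t - {v}" using v free_faceD(2)[OF g] by auto
  ultimately show ?thesis unfolding v by (intro free_faceI) (auto simp: mem_deletion)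
qed

section \<open>Greedy collapsing in dimension at most two\<close>

context
  fixes d :: int and K :: "'a set set"
  assumes K: "simplicial_complex K"
    and IH: "\<And>(L :: 'a set set) s t. simplicial_complex L \<Longrightarrow> card L < card K \<Longrightarrow> d_collapsible d L \<Longrightarrow>
      free_face L s t \<Longrightarrow> int (card s) \<le> d \<Longrightarrow> d_collapsible d (deletion L {s})"
begin

text \<open>
  The diamond: if each of \<open>f\<close> and \<open>g\<close> is still collapsible after the other one, the induction
  hypothesis collapses \<open>g\<close> after \<open>f\<close>, and the result also arises by collapsing \<open>f\<close> after \<open>g\<close>.
\<close>

lemma good_transfer:
  assumes f: "free_face K f t" and good: "d_collapsible d (deletion K {f})"
    and gf: "free_face (deletion K {f}) g u" and fg: "free_face (deletion K {g}) f w"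
    and d: "int (card f) \<le> d" "int (card g) \<le> d"
  shows "d_collapsible d (deletion K {g})"
proof -
  have "d_collapsible d (deletion (deletion K {f}) {g})"
    by (rule IH[OF simplicial_complex_deletion[OF K] card_deletion_less[OF K f] good gf d(2)])
  then have "d_collapsible d (deletion (deletion K {g}) {f})"
    by (simp add: deletion_deletion insert_commute)
  then show ?thesis by (rule d_collapsible_step[OF simplicial_complex_deletion[OF K] fg d(1)])
qed

text \<open>
  Faces with different maximal faces do not interfere: neither maximal face is destroyed by the
  other collapse.
\<close>

lemma good_transfer_apart:
  assumes f: "free_face K f t" and g: "free_face K g u" and "\<not> f \<subseteq> u"
    and good: "d_collapsible d (deletion K {f})"
    and d: "int (card f) \<le> d" "int (card g) \<le> d"
  shows "d_collapsible d (deletion K {g})"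
proof -
  have "\<not> g \<subseteq> t"
    using free_faceD(3)[OF g free_faceD(1)[OF f]] free_faceD(2)[OF f] \<open>\<not> f \<subseteq> u\<close> by blast
  then have "free_face (deletion K {g}) f t" using f by (intro free_face_deletion) auto
  moreover have "free_face (deletion K {f}) g u"
    using g \<open>\<not> f \<subseteq> u\<close> by (intro free_face_deletion) auto
  ultimately show ?thesis using good_transfer[OF f good _ _ d] by blast
qed

text \<open>
  If \<open>f\<close> and \<open>g\<close> are incomparable this is the diamond. If one of them contains the other, then one
  of the two second collapses is void, because deleting above the smaller face already deletes above
  the larger one.
\<close>

lemma good_transfer_neighbour:
  assumes f: "free_face K f t" and g: "free_face K g t"
    and near: "card (f - g) \<le> 1" "card (g - f) \<le> 1"
    and good: "d_collapsible d (deletion K {f})"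
    and d: "int (card f) \<le> d" "int (card g) \<le> d"
  shows "d_collapsible d (deletion K {g})"
proof -
  have sub: "deletion K {a, b} = deletion K {a}" if "a \<subseteq> b" for a b :: "'a set"
    using that by (auto simp: deletion_def)
  have both: "d_collapsible d (deletion K {f, g})"
  proof (cases "f \<subseteq> g")
    case True
    then show ?thesis using good sub by simp
  next
    case False
    have "d_collapsible d (deletion (deletion K {f}) {g})"
      by (rule IH[OF simplicial_complex_deletion[OF K] card_deletion_less[OF K f] good
        free_face_deletion_neighbour[OF K f g near(1) False] d(2)])
    then show ?thesis by (simp add: deletion_deletion insert_commute)
  qed
  show ?thesis
  proof (cases "g \<subseteq> f")
    case True
    then show ?thesis using both sub[OF True] by (simp add: insert_commute)
  next
    case False
    show ?thesis
      by (rule d_collapsible_step[OF simplicial_complex_deletion[OF K]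
        free_face_deletion_neighbour[OF K g f near(2) False] d(1)])
        (use both in \<open>simp add: deletion_deletion\<close>)
  qed
qed

text \<open>
  Once the empty face or a vertex is collapsible with maximal face \<open>t\<close>, some singleton \<open>{x}\<close> is,
  unless \<open>t\<close> is empty. Then the collapsible faces inside \<open>t\<close> with at most two vertices form a
  connected graph, where adjacent faces differ from their intersection by at most one vertex each:
  an edge \<open>{y, z}\<close> reaches \<open>{x}\<close> through \<open>{x, y}\<close>.
\<close>

lemma good_transfer_small:
  assumes d2: "d \<le> 2" and v: "free_face K v t" "card v \<le> 1"
    and f: "free_face K f t" and g: "free_face K g t"
    and good: "d_collapsible d (deletion K {f})"
    and d: "int (card f) \<le> d" "int (card g) \<le> d"
  shows "d_collapsible d (deletion K {g})"
proof (cases "f = g")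
  case False
  have fin: "finite h" if "free_face K h t" for h
    using K that by (rule free_face_finite)
  obtain x where x: "free_face K {x} t"
  proof (cases "v = {}")
    case True
    have "t \<noteq> {}" using False free_faceD(2)[OF f] free_faceD(2)[OF g] by blast
    then obtain x where "x \<in> t" by blast
    then have "free_face K {x} t" using True by (intro free_face_mono[OF v(1)]) simp_all
    then show ?thesis by (rule that)
  next
    case False
    then have "card v = 1" using v fin[OF v(1)] by (simp add: le_Suc_eq)
    then obtain x where "v = {x}" by (rule card_1_singletonE)
    then show ?thesis using that v(1) by simp
  qed
  have "card f \<noteq> 0 \<or> card g \<noteq> 0" using False fin[OF f] fin[OF g] by auto
  then have d1: "1 \<le> d" using d by linarith
  then have dx: "int (card {x}) \<le> d" by simp
  note step = good_transfer_neighbour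
  have link: "d_collapsible d (deletion K {h}) \<longleftrightarrow> d_collapsible d (deletion K {{x}})"
    if h: "free_face K h t" "int (card h) \<le> d" for h
  proof (cases "card (h - {x}) \<le> 1")
    case True
    moreover have "card ({x} - h) \<le> 1" using card_mono[of "{x}" "{x} - h"] by simp
    ultimately show ?thesis using step[OF h(1) x _ _ _ h(2) dx] step[OF x h(1) _ _ _ dx h(2)] by blast
  next
    case large: False
    then have card: "card h = 2" "x \<notin> h" "d = 2"
      using h(2) d2 fin[OF h(1)] by (auto simp: card_Diff_singleton_if split: if_splits)
    then obtain y z where yz: "h = {y, z}" "y \<noteq> z" by (auto simp: card_2_iff)
    have xy: "free_face K {x, y} t"
      using free_faceD(2)[OF h(1)] free_faceD(2)[OF x] yz by (intro free_face_mono[OF x]) simp_all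
    have dxy: "int (card {x, y}) \<le> d" using card(3) card_mono[of "{x, y}"] by (simp add: card_insert_if)
    have "h - {x, y} = {z}" "{x, y} - h = {x}" "{x, y} - {x} = {y}" "{x} - {x, y} = {}"
      using yz card(2) by auto
    then have c: "card (h - {x, y}) \<le> 1" "card ({x, y} - h) \<le> 1"
      "card ({x, y} - {x}) \<le> 1" "card ({x} - {x, y}) \<le> 1" by simp_all
    show ?thesis
      using step[OF h(1) xy c(1,2) _ h(2) dxy] step[OF xy h(1) c(2,1) _ dxy h(2)]
        step[OF xy x c(3,4) _ dxy dx] step[OF x xy c(4,3) _ dx dxy] by blast
  qed
  show ?thesis using link[OF f d(1)] link[OF g d(2)] good by blast
qed (use good in simp)

text \<open>
  The case of disjoint edges cannot be handled by a diamond, because collapsing one of them leaves two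
  maximal faces above the other. It is excluded instead by an extremal choice of a set \<open>E\<close> of good
  edges. The predicate \<open>P\<close> keeps two properties of \<open>E\<close>: deleting it leaves a collapsible complex, and
  a face \<open>r\<close> outside \<open>t\<close> that can be collapsed with good result after \<open>E\<close> could have been
  collapsed with good result before \<open>E\<close>.
\<close>

lemma first_collapse_transfers:
  assumes d2: "d \<le> 2" and s1: "free_face K s1 t1" "int (card s1) \<le> d"
    and good1: "d_collapsible d (deletion K {s1})"
    and s: "free_face K s t" "int (card s) \<le> d"
  shows "d_collapsible d (deletion K {s})"
proof (rule ccontr)
  assume bad: "\<not> d_collapsible d (deletion K {s})"
  have "s1 \<subseteq> t" using good_transfer_apart[OF s1(1) s(1) _ good1 s1(2) s(2)] bad by blast
  then have "t \<subseteq> t1" using free_faceD(3)[OF s1(1) free_faceD(1)[OF s(1)]] by simp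
  then have "t1 \<subseteq> t"
    using free_faceD(3)[OF s(1) free_faceD(1)[OF s1(1)]] free_faceD(2)[OF s(1)] by simp
  with \<open>t \<subseteq> t1\<close> have "t1 = t" by simp
  with s1(1) have s1t: "free_face K s1 t" by simp
  have big: "card v \<ge> 2" if "free_face K v t" for v
    using good_transfer_small[OF d2 that _ s1t s(1) good1 s1(2) s(2)] bad by fastforce
  have d_eq: "d = 2" and card_s: "card s = 2" using big[OF s(1)] s(2) d2 by auto
  have fin: "finite h" if "free_face K h t" for h
    using K that by (rule free_face_finite)
  \<comment> \<open>The good edges with maximal face t. None of them meets s, since otherwise s would be good.\<close>
  define G where "G = {e. free_face K e t \<and> card e = 2 \<and> d_collapsible d (deletion K {e})}"
  have near: "card (e - h) \<le> 1 \<and> card (h - e) \<le> 1"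
    if "card e = 2" "card h = 2" "e \<inter> h \<noteq> {}" for e h :: "'a set"
  proof -
    have "finite e" "finite h" using that card.infinite by fastforce+
    then have "card (e \<inter> h) \<ge> 1" using that(3) by (simp add: Suc_le_eq card_gt_0_iff)
    moreover have "card (h \<inter> e) = card (e \<inter> h)" by (simp add: Int_commute)
    ultimately show ?thesis using that \<open>finite e\<close> \<open>finite h\<close>
      by (simp add: card_Diff_subset_Int)
  qed
  have G_meets: "h \<in> G" if "e \<in> G" "free_face K h t" "card h = 2" "e \<inter> h \<noteq> {}" for e h
    using that good_transfer_neighbour[of e t h] near[of e h] d_eq unfolding G_def by auto
  have G_apart: "e \<inter> s = {}" if "e \<in> G" for e
    using G_meets[OF that s(1) card_s] bad unfolding G_def by blast
  have s1G: "s1 \<in> G" using s1t s1(2) d_eq big good1 unfolding G_def by force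
  have G_top: "x \<subseteq> t" if "e \<in> G" "x \<in> K" "e \<subseteq> x" for e x
    using that free_faceD(3) unfolding G_def by blast
  define P where "P E \<longleftrightarrow> E \<subseteq> G \<and> s1 \<in> E \<and> d_collapsible d (deletion K E) \<and>
    (\<forall>r. \<not> r \<subseteq> t \<longrightarrow> d_collapsible d (deletion K (insert r E)) \<longrightarrow>
      d_collapsible d (deletion K {r}))" for E
  have P1: "P {s1}"
  proof -
    have "d_collapsible d (deletion K {r})"
      if r: "\<not> r \<subseteq> t" "d_collapsible d (deletion K {r, s1})" for r
    proof (rule d_collapsible_step[OF simplicial_complex_deletion[OF K]])
      show "free_face (deletion K {r}) s1 t" using free_face_deletion[OF s1t] r(1) by blast
    qed (use s1(2) r(2) in \<open>simp_all add: deletion_deletion insert_commute\<close>)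
    then show ?thesis using s1G good1 unfolding P_def by blast
  qed
  have "G \<subseteq> Pow t" using free_faceD(2) unfolding G_def by blast
  moreover have "finite t" using K free_faceD(1)[OF s(1)] by (rule simplicial_complex_finite_face)
  ultimately have finG: "finite G" by (meson finite_Pow_iff finite_subset)
  have "finite {E. P E}" by (rule finite_subset[of _ "Pow G"]) (use finG in \<open>auto simp: P_def\<close>)
  then obtain E where E: "P E" and maxE: "\<And>F. P F \<Longrightarrow> E \<subseteq> F \<Longrightarrow> F = E"
    using finite_has_maximal2[of "{E. P E}" "{s1}"] P1 by (metis mem_Collect_eq)
  have EG: "E \<subseteq> G" and s1E: "s1 \<in> E" and goodE: "d_collapsible d (deletion K E)"
    and outer: "\<And>r. \<not> r \<subseteq> t \<Longrightarrow> d_collapsible d (deletion K (insert r E)) \<Longrightarrow>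
      d_collapsible d (deletion K {r})"
    using E unfolding P_def by blast+
  have E_card: "card e = 2" if "e \<in> E" for e using that EG unfolding G_def by blast
  have E_s: "\<not> e \<subseteq> r \<union> s" if "e \<in> E" "\<not> e \<subseteq> r" for e r
    using that G_apart EG by blast
  \<comment> \<open>The edge s survives, so the remaining complex is nonempty and has a next collapse r.\<close>
  have "s \<in> deletion K E"
    using E_s[of _ "{}"] E_card free_face_in[OF K s(1) free_faceD(2)[OF s(1)]]
    unfolding mem_deletion by fastforce
  then have "deletion K E \<noteq> {}" by blast
  then obtain r u where r: "free_face (deletion K E) r u" "int (card r) \<le> d"
    and goodr: "d_collapsible d (deletion K (insert r E))"
    using d_collapsible_cases[OF simplicial_complex_deletion[OF K] goodE]
    unfolding deletion_deletion by metis
  have ru: "u \<in> K" "r \<subseteq> u" "\<And>x. x \<in> deletion K E \<Longrightarrow> r \<subseteq> x \<Longrightarrow> x \<subseteq> u"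
    and u_avoids: "\<And>e. e \<in> E \<Longrightarrow> \<not> e \<subseteq> u"
    using free_faceD[OF r(1)] unfolding mem_deletion by simp_all
  show False
  proof (cases "r \<subseteq> t")
    case False
    \<comment> \<open>All deleted faces lie in t, so r had the same faces above it in K.
        It can be collapsed first, and it does not interfere with s.\<close>
    have "x \<in> deletion K E" if "x \<in> K" "r \<subseteq> x" for x
      using that False G_top EG unfolding mem_deletion by blast
    then have "free_face K r u" by (intro free_faceI ru)
    from good_transfer_apart[OF this s(1) False outer[OF False goodr] r(2) s(2)] bad
    show False by blast
  next
    case True
    \<comment> \<open>As r and s lie together in a surviving face, the maximal face u of r contains s.
        Hence u lies in t, and r is collapsible in K with maximal face t.\<close>
    have "r \<union> s \<in> K"
      using free_face_in[OF K s(1)] True free_faceD(2)[OF s(1)] by (metis Un_least)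
    then have "r \<union> s \<in> deletion K E"
      using E_s u_avoids ru(2) unfolding mem_deletion by blast
    then have "s \<subseteq> u" using ru(3) by blast
    then have ut: "u \<subseteq> t" by (rule free_faceD(3)[OF s(1) ru(1)])
    have "x \<subseteq> t" if "x \<in> K" "r \<subseteq> x" for x
      using that ru(3) ut G_top EG unfolding mem_deletion by blast
    then have rt: "free_face K r t" by (intro free_faceI free_faceD(1)[OF s(1)] True)
    then have card_r: "card r = 2" using big r(2) d_eq by force
    \<comment> \<open>If r met no edge of E, it could be enlarged by each of the two ends of s1 separately.
        Both ends would then lie in u, which would contain the deleted edge s1.\<close>
    have "\<exists>e\<in>E. e \<inter> r \<noteq> {}"
    proof (rule ccontr)
      assume apart: "\<not> (\<exists>e\<in>E. e \<inter> r \<noteq> {})"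
      have "c \<in> u" if c: "c \<in> s1" for c
      proof -
        have "\<not> e \<subseteq> insert c r" if "e \<in> E" for e
        proof
          assume "e \<subseteq> insert c r"
          then have "e \<subseteq> {c}" using apart that by blast
          then have "card e \<le> 1" using card_mono[of "{c}" e] by simp
          then show False using E_card[OF that] by simp
        qed
        moreover have "insert c r \<in> K"
          using free_face_in[OF K s(1)] c free_faceD(2)[OF s1t] True by (metis insert_subset subsetD)
        ultimately have "insert c r \<in> deletion K E" unfolding mem_deletion by blast
        then show ?thesis using ru(3) by blast
      qed
      then show False using u_avoids[OF s1E] by blast
    qed
    \<comment> \<open>So r is a good edge, and it can be added to E.\<close>
    then have rG: "r \<in> G" using G_meets[OF _ rt card_r] EG by blast
    have "d_collapsible d (deletion K {q})"
      if q: "\<not> q \<subseteq> t" "d_collapsible d (deletion K (insert q (insert r E)))" for q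
    proof (rule outer[OF q(1)])
      have "free_face (deletion (deletion K E) {q}) r u"
        using free_face_deletion[OF r(1)] q(1) ut by blast
      then have "free_face (deletion K (insert q E)) r u" by (simp add: deletion_deletion)
      from d_collapsible_step[OF simplicial_complex_deletion[OF K] this r(2)] q(2)
      show "d_collapsible d (deletion K (insert q E))"
        by (simp add: deletion_deletion insert_commute)
    qed
    then have "P (insert r E)" using rG EG s1E goodr unfolding P_def by blast
    then have "r \<in> E" using maxE[of "insert r E"] by blast
    then show False using u_avoids ru(2) by blast
  qed
qed

end

text \<open>
  An empty complex has no collapsible face; otherwise the first step of a collapsing sequence of \<open>K\<close>
  transfers to \<open>s\<close>.
\<close>

lemma free_faces_good:
  assumes "d \<le> 2" "simplicial_complex K" "d_collapsible d K"
    and "free_face K s t" "int (card s) \<le> d"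
  shows "d_collapsible d (deletion K {s})"
  using assms(2-)
proof (induction "card K" arbitrary: K s t rule: less_induct)
  case less
  show ?case
    using less.prems(1,2)
  proof (cases rule: d_collapsible_cases)
    case 1
    then show ?thesis using less.prems(3) unfolding free_face_def by blast
  next
    case (2 s1 t1)
    show ?thesis
      by (rule first_collapse_transfers[OF less.prems(1) _ assms(1) 2 less.prems(3,4)])
        (use less.hyps in blast)
  qed
qed

section \<open>Certificates for collapsibility and for its failure\<close>

text \<open>
  A maximal face lies in no other face, so if it is small enough it can be removed alone. Repeating
  this empties the complex.
\<close>

lemma d_collapsible_if_small_faces:
  assumes "simplicial_complex K" "\<And>x. x \<in> K \<Longrightarrow> int (card x) \<le> d"
  shows "d_collapsible d K"
  using assms
proof (induction "card K" arbitrary: K rule: less_induct)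
  case less
  show ?case
  proof (cases "K = {}")
    case True
    then show ?thesis by (simp add: d_collapsible_empty)
  next
    case False
    have "finite K" using less.prems(1) by (simp add: simplicial_complex_def)
    then obtain m where m: "m \<in> K" "\<forall>b\<in>K. m \<subseteq> b \<longrightarrow> m = b"
      using finite_has_maximal False by metis
    then have free: "free_face K m m" by (intro free_faceI) auto
    have "d_collapsible d (deletion K {m})"
      by (rule less.hyps[OF card_deletion_less[OF less.prems(1) free]
        simplicial_complex_deletion[OF less.prems(1)]]) (simp add: less.prems(2) mem_deletion)
    then show ?thesis by (rule d_collapsible_step[OF less.prems(1) free less.prems(2)[OF m(1)]])
  qed
qed

text \<open>
  An order in which faces \<open>t\<close> can be removed one after the other, each by collapsing a face \<open>s\<close> with
  \<open>n\<close> vertices that lies in none of the later ones.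
\<close>

fun peeling :: "nat \<Rightarrow> ('a set \<times> 'a set) list \<Rightarrow> bool" where
  "peeling n [] \<longleftrightarrow> True"
| "peeling n ((t, s) # ps) \<longleftrightarrow> s \<subseteq> t \<and> card s = n \<and>
     (\<forall>t' \<in> fst ` set ps. \<not> s \<subseteq> t') \<and> peeling n ps"

text \<open>
  A face above \<open>s\<close> is either \<open>s\<close> itself or large, hence \<open>t\<close>, so the next pair of the list is a collapse.
  After the last one only small faces are left.
\<close>

lemma d_collapsible_if_peeling:
  assumes "simplicial_complex K" "peeling n ps" "{x \<in> K. n < card x} = fst ` set ps"
  shows "d_collapsible (int n) K"
  using assms
proof (induction ps arbitrary: K)
  case Nil
  then have "{x \<in> K. n < card x} = {}" by simp
  then have "int (card x) \<le> int n" if "x \<in> K" for x using that by fastforce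
  with Nil.prems(1) show ?case by (rule d_collapsible_if_small_faces)
next
  case (Cons p ps)
  obtain t s where p: "p = (t, s)" by (cases p)
  have st: "s \<subseteq> t" "card s = n" "peeling n ps"
    and avoid: "\<And>t'. t' \<in> fst ` set ps \<Longrightarrow> \<not> s \<subseteq> t'"
    using Cons.prems(2) unfolding p by auto
  have large: "x \<in> K \<and> n < card x \<longleftrightarrow> x = t \<or> x \<in> fst ` set ps" for x
  proof -
    have "{x \<in> K. n < card x} = insert t (fst ` set ps)" using Cons.prems(3) by (simp add: p)
    then show ?thesis by blast
  qed
  have free: "free_face K s t"
  proof (rule free_faceI)
    show "t \<in> K" "s \<subseteq> t" using large st(1) by blast+
    fix x assume x: "x \<in> K" "s \<subseteq> x"
    show "x \<subseteq> t"
    proof (cases "n < card x")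
      case True
      then show ?thesis using large[of x] x avoid[of x] by auto
    next
      case False
      have "finite x" using Cons.prems(1) x(1) by (rule simplicial_complex_finite_face)
      then have "s = x" using x(2) False st(2) by (intro card_subset_eq) (auto dest: card_mono)
      then show ?thesis using st(1) by simp
    qed
  qed
  have "{x \<in> deletion K {s}. n < card x} = fst ` set ps"
  proof (rule set_eqI)
    fix x
    show "x \<in> {x \<in> deletion K {s}. n < card x} \<longleftrightarrow> x \<in> fst ` set ps"
      using large[of x] avoid[of x] st(1) by (auto simp: mem_deletion)
  qed
  then have "d_collapsible (int n) (deletion K {s})"
    by (rule Cons.IH[OF simplicial_complex_deletion[OF Cons.prems(1)] st(3)])
  from d_collapsible_step[OF Cons.prems(1) free _ this] show ?case by (simp add: st(2))
qed

text \<open>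
  Each facet \<open>t - {v}\<close> of a member lies in a second member \<open>u\<close>; the condition \<open>v \<notin> u\<close> expresses that \<open>u\<close>
  differs from \<open>t\<close>.
\<close>

definition rigid :: "nat \<Rightarrow> 'a set set \<Rightarrow> bool" where
  "rigid n T \<longleftrightarrow> T \<noteq> {} \<and>
     (\<forall>t\<in>T. card t = Suc n \<and> (\<forall>v\<in>t. \<exists>u\<in>T. v \<notin> u \<and> t - {v} \<subseteq> u))"

text \<open>
  A collapsible face \<open>s\<close> with at most \<open>n\<close> vertices below a member \<open>u\<close> of \<open>T\<close> lies in a facet of \<open>u\<close>, hence
  in a second member. Both have the maximal dimension of \<open>L\<close>, so \<open>s\<close> would lie in two maximal faces.
  Thus no collapse ever removes a member of \<open>T\<close>.
\<close>

lemma not_d_collapsible_if_rigid: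
  assumes "simplicial_complex L" "\<And>x. x \<in> L \<Longrightarrow> card x \<le> Suc n" "rigid n T" "T \<subseteq> L"
  shows "\<not> d_collapsible (int n) L"
  using assms
proof (induction "card L" arbitrary: L rule: less_induct)
  case less
  show ?case
  proof
    assume "d_collapsible (int n) L"
    with less.prems(1) show False
    proof (cases rule: d_collapsible_cases)
      case 1
      then show False using less.prems(3,4) by (simp add: rigid_def)
    next
      case (2 s t)
      have "\<not> s \<subseteq> u" if u: "u \<in> T" for u
      proof
        assume su: "s \<subseteq> u"
        have card_T: "card w = Suc n" if "w \<in> T" for w
          using that less.prems(3) by (simp add: rigid_def)
        have "card s < card u" using 2(2) card_T[OF u] by simp
        then have "s \<noteq> u" by auto
        then obtain v where v: "v \<in> u" "v \<notin> s" using su by blast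
        then obtain w where w: "w \<in> T" "v \<notin> w" "u - {v} \<subseteq> w"
          using less.prems(3) u unfolding rigid_def by metis
        have finite_t: "finite t" and card_t: "card t \<le> Suc n"
          using free_faceD(1)[OF 2(1)] less.prems(1,2) simplicial_complex_finite_face by auto
        have "x = t" if "x \<in> T" "s \<subseteq> x" for x
        proof (rule card_seteq[OF finite_t])
          show "x \<subseteq> t" using free_faceD(3)[OF 2(1)] that less.prems(4) by blast
          show "card t \<le> card x" using card_t card_T[OF that(1)] by simp
        qed
        then have "u = t" "w = t" using u su w v by blast+
        then show False using v(1) w(2) by simp
      qed
      then have "T \<subseteq> deletion L {s}" using less.prems(4) by (auto simp: mem_deletion)
      then have "\<not> d_collapsible (int n) (deletion L {s})"
        using less.prems(2) by (intro less.hyps[OF card_deletion_less[OF less.prems(1) 2(1)]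
          simplicial_complex_deletion[OF less.prems(1)] _ less.prems(3)]) (simp_all add: mem_deletion)
      then show False using 2(3) by simp
    qed
  qed
qed

lemma simplicial_complex_elementary_d_collapse:
  assumes "simplicial_complex K" "elementary_d_collapse d K L"
  shows "simplicial_complex L"
  using assms simplicial_complex_deletion unfolding elementary_d_collapse_iff[OF assms(1)] by blast

text \<open>
  The face collapsed when the path leaves the collapsible complexes for the first time is bad.
\<close>

lemma bad_face_on_path:
  fixes K L :: "'a set set"
  assumes "d_collapses_to d K L" "simplicial_complex K" "d_collapsible d K" "\<not> d_collapsible d L"
  shows "\<exists>(M :: 'a set set) s. simplicial_complex M \<and> d_collapsible d M \<and> bad_face d M s"
  using assms unfolding d_collapses_to_def
proof (induction rule: converse_rtranclp_induct)
  case base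
  then show ?case by blast
next
  case (step K M)
  show ?case
  proof (cases "d_collapsible d M")
    case True
    have "simplicial_complex M"
      by (rule simplicial_complex_elementary_d_collapse[OF step.prems(1) step.hyps(1)])
    then show ?thesis using True step.prems(3) by (rule step.IH)
  next
    case False
    obtain s where "d_collapsible_face d K s" "M = collapse_at K s"
      using step.hyps(1) unfolding elementary_d_collapse_def by blast
    then have "bad_face d K s" using False by (simp add: bad_face_def)
    then show ?thesis using step.prems(1,2) by blast
  qed
qed

section \<open>Cones and suspensions\<close>

text \<open>
  The set \<open>X \<union> insert p ` M\<close> is \<open>X\<close> with a cone with apex \<open>p\<close> attached along the subcomplex \<open>M\<close>. If \<open>M\<close> is
  the empty complex, nothing is attached, not even the vertex \<open>p\<close>.
\<close>

lemma simplicial_complex_cone: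
  assumes "simplicial_complex X" "simplicial_complex M" "M \<subseteq> X"
  shows "simplicial_complex (X \<union> insert p ` M)"
  unfolding simplicial_complex_def
proof (intro conjI ballI allI impI)
  show "finite (X \<union> insert p ` M)" using assms by (simp add: simplicial_complex_def)
  show "finite A" if "A \<in> X \<union> insert p ` M" for A
    using that simplicial_complex_finite_face[OF assms(1)] simplicial_complex_finite_face[OF assms(2)]
    by auto
  show "B \<in> X \<union> insert p ` M" if A: "A \<in> X \<union> insert p ` M" and B: "B \<subseteq> A" for A B
  proof (cases "A \<in> X")
    case True
    then show ?thesis using simplicial_complex_subset[OF assms(1) True B] by simp
  next
    case False
    then obtain m where m: "m \<in> M" "A = insert p m" using A by blast
    have "B - {p} \<subseteq> m" using B m(2) by blast
    then have BM: "B - {p} \<in> M" by (rule simplicial_complex_subset[OF assms(2) m(1)])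
    show ?thesis
    proof (cases "p \<in> B")
      case True
      then have "B = insert p (B - {p})" by blast
      then show ?thesis using BM by blast
    next
      case False
      then have "B = B - {p}" by blast
      then show ?thesis using BM assms(3) by auto
    qed
  qed
qed

text \<open>
  The faces above \<open>insert p s\<close> are the faces of \<open>M\<close> above \<open>s\<close> with \<open>p\<close> added. So a collapse of \<open>s\<close> in
  the base, made at \<open>insert p s\<close>, shrinks the cone to the cone over the collapsed base.
\<close>

lemma collapses_in_cone:
  assumes "d_collapses_to d M N" "simplicial_complex M" "M \<subseteq> X" "simplicial_complex X" "p \<notin> \<Union>X"
  shows "d_collapses_to (d + 1) (X \<union> insert p ` M) (X \<union> insert p ` N)"
  using assms unfolding d_collapses_to_def
proof (induction rule: converse_rtranclp_induct)
  case base
  show ?case by simp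
next
  case (step M M')
  have M: "simplicial_complex M" "M \<subseteq> X" and X: "simplicial_complex X" "p \<notin> \<Union>X"
    using step.prems by blast+
  obtain s t where s: "free_face M s t" "int (card s) \<le> d" "M' = deletion M {s}"
    using step.hyps(1) elementary_d_collapse_iff[OF M(1)] by metis
  have fresh: "p \<notin> x" if "x \<in> X" for x using that X(2) by blast
  have sX: "s \<in> X" using free_face_in[OF M(1) s(1) free_faceD(2)[OF s(1)]] M(2) by blast
  have "free_face (X \<union> insert p ` M) (insert p s) (insert p t)"
  proof (rule free_faceI)
    show "insert p t \<in> X \<union> insert p ` M" "insert p s \<subseteq> insert p t"
      using free_faceD(1,2)[OF s(1)] by blast+
    fix x assume x: "x \<in> X \<union> insert p ` M" "insert p s \<subseteq> x"
    then obtain m where m: "m \<in> M" "x = insert p m" using fresh[of x] by blast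
    then have "s \<subseteq> m" using x(2) fresh[OF sX] by blast
    then have "m \<subseteq> t" by (rule free_faceD(3)[OF s(1) m(1)])
    then show "x \<subseteq> insert p t" using m(2) by blast
  qed
  moreover have "int (card (insert p s)) \<le> d + 1"
    using s(2) card_insert_if[of s p] card.infinite[of "insert p s"]
    by (cases "finite s") (auto simp: card_insert_if)
  moreover have "X \<union> insert p ` M' = deletion (X \<union> insert p ` M) {insert p s}"
  proof -
    have "insert p s \<subseteq> insert p m \<longleftrightarrow> s \<subseteq> m" if "m \<in> M" for m
      using fresh[OF sX] by blast
    moreover have "\<not> insert p s \<subseteq> x" if "x \<in> X" for x using fresh[OF that] by blast
    ultimately show ?thesis unfolding s(3) deletion_def by auto
  qed
  ultimately have "elementary_d_collapse (d + 1) (X \<union> insert p ` M) (X \<union> insert p ` M')"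
    unfolding elementary_d_collapse_iff[OF simplicial_complex_cone[OF X(1) M]]
    by (intro exI conjI)
  moreover have "(elementary_d_collapse (d + 1))\<^sup>*\<^sup>* (X \<union> insert p ` M') (X \<union> insert p ` N)"
  proof (rule step.IH[OF _ _ X])
    show "simplicial_complex M'" unfolding s(3) by (rule simplicial_complex_deletion[OF M(1)])
    show "M' \<subseteq> X" using M(2) unfolding s(3) deletion_def by blast
  qed
  ultimately show ?case by (rule converse_rtranclp_into_rtranclp)
qed

lemma d_collapses_to_subset:
  assumes "d_collapses_to d K L" "simplicial_complex K"
  shows "simplicial_complex L \<and> L \<subseteq> K"
  using assms(1) unfolding d_collapses_to_def
proof (induction rule: rtranclp_induct)
  case base
  show ?case using assms(2) by simp
next
  case (step M N)
  then show ?case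
    using simplicial_complex_elementary_d_collapse
    unfolding elementary_d_collapse_def collapse_at_def by blast
qed

lemma d_collapsible_mono:
  assumes "d_collapsible d K" "d \<le> e" shows "d_collapsible e K"
proof -
  have "elementary_d_collapse d \<le> elementary_d_collapse e"
    using assms(2) unfolding elementary_d_collapse_def d_collapsible_face_def by force
  then show ?thesis
    using assms(1) rtranclp_mono unfolding d_collapsible_def d_collapses_to_def by blast
qed

text \<open>
  The cones with apices \<open>p\<close> and \<open>q\<close> form the suspension of \<open>K\<close>. They are shrunk one after the other,
  and the base \<open>K\<close> itself remains.
\<close>

lemma collapses_in_suspension:
  assumes KL: "d_collapses_to d K L" and K: "simplicial_complex K"
    and pq: "p \<notin> \<Union>K" "q \<notin> \<Union>K" "p \<noteq> q"
  shows "d_collapses_to (d + 1) (K \<union> insert p ` K \<union> insert q ` K) (K \<union> insert p ` L \<union> insert q ` L)"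
proof -
  have L: "simplicial_complex L" "L \<subseteq> K" using d_collapses_to_subset[OF KL K] by auto
  have "d_collapses_to (d + 1) (K \<union> insert p ` K \<union> insert q ` K) (K \<union> insert p ` K \<union> insert q ` L)"
    using pq by (intro collapses_in_cone[OF KL K] simplicial_complex_cone K) auto
  moreover have "d_collapses_to (d + 1) (K \<union> insert q ` L \<union> insert p ` K) (K \<union> insert q ` L \<union> insert p ` L)"
    using pq L(2) by (intro collapses_in_cone[OF KL K] simplicial_complex_cone K L) auto
  ultimately show ?thesis
    unfolding d_collapses_to_def Un_assoc Un_commute[of "insert q ` L"] by (rule rtranclp_trans)
qed

text \<open>
  The facet of a cone opposite to the apex is shared with the cone with the other apex; the other
  facets are shared with the cone over the second member given by \<open>T\<close>.
\<close>

lemma rigid_suspension: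
  assumes T: "rigid n T" and pq: "p \<notin> \<Union>T" "q \<notin> \<Union>T" "p \<noteq> q"
  shows "rigid (Suc n) (insert p ` T \<union> insert q ` T)"
proof -
  have cone: "card (insert a t) = Suc (Suc n) \<and>
      (\<forall>v\<in>insert a t. \<exists>u \<in> insert a ` T \<union> insert b ` T. v \<notin> u \<and> insert a t - {v} \<subseteq> u)"
    if t: "t \<in> T" and ab: "a \<notin> \<Union>T" "a \<noteq> b" for a b t
  proof (intro conjI ballI)
    have at: "a \<notin> t" and card_t: "card t = Suc n" using t ab(1) T by (auto simp: rigid_def)
    then have "finite t" using card.infinite by fastforce
    then show "card (insert a t) = Suc (Suc n)" using at card_t by simp
    fix v assume v: "v \<in> insert a t"
    show "\<exists>u \<in> insert a ` T \<union> insert b ` T. v \<notin> u \<and> insert a t - {v} \<subseteq> u"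
    proof (cases "v = a")
      case True
      then show ?thesis using t at ab(2) by (intro bexI[of _ "insert b t"]) auto
    next
      case False
      then obtain u where u: "u \<in> T" "v \<notin> u" "t - {v} \<subseteq> u" using v t T unfolding rigid_def by blast
      then show ?thesis using False by (intro bexI[of _ "insert a u"]) auto
    qed
  qed
  have "card s = Suc (Suc n) \<and> (\<forall>v\<in>s. \<exists>u \<in> insert p ` T \<union> insert q ` T. v \<notin> u \<and> s - {v} \<subseteq> u)"
    if "s \<in> insert p ` T \<union> insert q ` T" for s
  proof -
    from that consider t where "t \<in> T" "s = insert p t" | t where "t \<in> T" "s = insert q t"
      by blast
    then show ?thesis
    proof cases
      case 1
      show ?thesis using cone[OF 1(1) pq(1,3)] unfolding 1(2) .
    next
      case 2
      show ?thesis
        using cone[OF 2(1) pq(2) pq(3)[symmetric]]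
        unfolding 2(2) Un_commute[of "insert q ` T" "insert p ` T"] .
    qed
  qed
  moreover have "insert p ` T \<union> insert q ` T \<noteq> {}" using T by (simp add: rigid_def)
  ultimately show ?thesis unfolding rigid_def by (intro conjI ballI) simp_all
qed

text \<open>
  The bound on the faces of \<open>K\<close> serves the suspension: all of \<open>K\<close> stays inside the suspension of \<open>L\<close>, whose
  faces must not exceed the dimension of the rigid set.
\<close>

definition greedy_trap :: "nat \<Rightarrow> 'a set set \<Rightarrow> 'a set set \<Rightarrow> bool" where
  "greedy_trap n K L \<longleftrightarrow> simplicial_complex K \<and> (\<forall>x\<in>K. card x \<le> n + 2) \<and>
     d_collapsible (int n) K \<and> d_collapses_to (int n) K L \<and>
     (\<forall>x\<in>L. card x \<le> n + 1) \<and> (\<exists>T\<subseteq>L. rigid n T)"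

lemma bad_face_if_greedy_trap:
  fixes K L :: "'a set set"
  assumes "greedy_trap n K L"
  shows "\<exists>(M :: 'a set set) s. simplicial_complex M \<and> d_collapsible (int n) M \<and> bad_face (int n) M s"
proof -
  note trap = assms[unfolded greedy_trap_def]
  then obtain T where T: "T \<subseteq> L" "rigid n T" by blast
  have "simplicial_complex L" using d_collapses_to_subset trap by blast
  then have "\<not> d_collapsible (int n) L"
    using trap by (intro not_d_collapsible_if_rigid[OF _ _ T(2,1)]) auto
  then show ?thesis using trap by (intro bad_face_on_path[of "int n" K L]) auto
qed

text \<open>
  The suspension of \<open>K\<close> shrinks to \<open>K\<close> when the base of both cones is collapsed to the empty complex,
  and \<open>K\<close> is collapsible. When it is collapsed to \<open>L\<close> instead, the suspension of the rigid set
  survives.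
\<close>

lemma greedy_trap_suspension:
  assumes trap: "greedy_trap n K L" and pq: "p \<notin> \<Union>K" "q \<notin> \<Union>K" "p \<noteq> q"
  shows "greedy_trap (Suc n) (K \<union> insert p ` K \<union> insert q ` K) (K \<union> insert p ` L \<union> insert q ` L)"
proof -
  have K: "simplicial_complex K" "\<And>x. x \<in> K \<Longrightarrow> card x \<le> n + 2" "d_collapsible (int n) K"
    and KL: "d_collapses_to (int n) K L" and L: "\<And>x. x \<in> L \<Longrightarrow> card x \<le> n + 1"
    using trap by (auto simp: greedy_trap_def)
  obtain T where T: "T \<subseteq> L" "rigid n T" using trap by (auto simp: greedy_trap_def)
  have LK: "L \<subseteq> K" using d_collapses_to_subset[OF KL K(1)] by simp
  have card_insert: "card (insert a x) \<le> Suc (card x)" for a :: 'a and x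
    by (cases "finite x") (simp_all add: card_insert_if)
  have "d_collapses_to (int n) K {}" using K(3) by (simp add: d_collapsible_def)
  from collapses_in_suspension[OF this K(1) pq]
  have "d_collapses_to (int (Suc n)) (K \<union> insert p ` K \<union> insert q ` K) K" by (simp add: add.commute)
  moreover have "d_collapses_to (int (Suc n)) K {}"
    using d_collapsible_mono[OF K(3), of "int (Suc n)"] by (simp add: d_collapsible_def)
  ultimately have collapsible: "d_collapsible (int (Suc n)) (K \<union> insert p ` K \<union> insert q ` K)"
    unfolding d_collapsible_def d_collapses_to_def by (rule rtranclp_trans)
  have rigid: "rigid (Suc n) (insert p ` T \<union> insert q ` T)"
    using T(1) LK pq by (intro rigid_suspension[OF T(2)]) auto
  show ?thesis
    unfolding greedy_trap_def
  proof (intro conjI ballI exI)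
    show "simplicial_complex (K \<union> insert p ` K \<union> insert q ` K)"
      by (intro simplicial_complex_cone K(1)) auto
    show "card x \<le> Suc n + 2" if "x \<in> K \<union> insert p ` K \<union> insert q ` K" for x
      using that K(2) card_insert by (fastforce intro: order_trans)
    show "card x \<le> Suc n + 1" if "x \<in> K \<union> insert p ` L \<union> insert q ` L" for x
      using that K(2) L card_insert by (fastforce intro: order_trans)
    show "d_collapses_to (int (Suc n)) (K \<union> insert p ` K \<union> insert q ` K)
        (K \<union> insert p ` L \<union> insert q ` L)"
      using collapses_in_suspension[OF KL K(1) pq] by (simp add: add.commute)
    show "insert p ` T \<union> insert q ` T \<subseteq> K \<union> insert p ` L \<union> insert q ` L" using T(1) by blast
  qed (fact collapsible rigid)+
qed

section \<open>A trap in dimension three\<close>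

text \<open>
  These tetrahedra come from a computer search on eight vertices. Three properties are needed: none
  contains a triangle 012, 123 or 034; together with 0134 and 0234 they can be peeled off; together with
  0123, 0124 and 1234 they are rigid.
\<close>

definition outer_tetrahedra :: "nat set set" where
  "outer_tetrahedra = {
    {0,1,3,5}, {0,1,4,6}, {0,1,5,6}, {0,2,3,7}, {0,2,4,5}, {0,2,5,6},
    {0,2,6,7}, {0,3,5,7}, {0,4,5,6}, {0,4,5,7}, {0,4,6,7}, {1,2,4,6},
    {1,2,5,6}, {1,2,5,7}, {1,2,6,7}, {1,3,4,5}, {1,4,5,6}, {1,5,6,7},
    {2,3,4,5}, {2,3,5,6}, {2,3,6,7}, {2,4,5,7}, {2,4,6,7}, {3,5,6,7}}"

definition trap_complex :: "nat set set" where
  "trap_complex = {x. \<exists>f \<in> insert {0,1,2,3,4} outer_tetrahedra. x \<subseteq> f}"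

text \<open>
  The order starts at the triangle 124, which lies in one outer tetrahedron and in neither 0134 nor
  0234.
\<close>

definition peeling_order :: "(nat set \<times> nat set) list" where
  "peeling_order = [
    ({1,2,4,6}, {1,2,4}), ({2,4,6,7}, {2,4,6}), ({2,4,5,7}, {2,4,7}), ({1,2,5,7}, {2,5,7}),
    ({1,2,5,6}, {1,2,5}), ({1,2,6,7}, {1,2,6}), ({1,5,6,7}, {1,5,7}), ({0,4,5,7}, {4,5,7}),
    ({0,4,6,7}, {0,4,7}), ({0,3,5,7}, {0,5,7}), ({0,1,3,5}, {0,3,5}), ({0,1,3,4}, {0,1,3}),
    ({0,1,4,6}, {0,1,4}), ({0,1,5,6}, {0,1,5}), ({0,2,3,4}, {0,3,4}), ({0,2,3,7}, {0,2,3}),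
    ({0,2,4,5}, {0,2,4}), ({0,2,5,6}, {0,2,5}), ({0,2,6,7}, {0,2,6}), ({0,4,5,6}, {0,4,5}),
    ({1,3,4,5}, {1,3,4}), ({1,4,5,6}, {1,4,5}), ({2,3,4,5}, {2,3,4}), ({2,3,5,6}, {2,3,5}),
    ({2,3,6,7}, {2,3,6}), ({3,5,6,7}, {3,5,6})]"

lemma peeling_peeling_order: "peeling 3 peeling_order"
  unfolding peeling_order_def by simp

lemma set_peeling_order:
  "fst ` set peeling_order = insert {0,1,3,4} (insert {0,2,3,4} outer_tetrahedra)"
  unfolding peeling_order_def outer_tetrahedra_def
  by (intro equalityI; simp only: list.set image_insert image_empty fst_conv
    insert_subset empty_subsetI insert_iff simp_thms)

lemma card_outer_tetrahedra: "f \<in> outer_tetrahedra \<Longrightarrow> card f = 4"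
proof -
  have "\<forall>f\<in>outer_tetrahedra. card f = 4" unfolding outer_tetrahedra_def by simp
  then show "f \<in> outer_tetrahedra \<Longrightarrow> card f = 4" by blast
qed

lemma outer_tetrahedra_avoid:
  assumes "f \<in> outer_tetrahedra"
  shows "\<not> {0,1,2} \<subseteq> f" "\<not> {1,2,3} \<subseteq> f" "\<not> {0,3,4} \<subseteq> f"
proof -
  have "\<forall>f\<in>outer_tetrahedra. \<not> {0,1,2} \<subseteq> f \<and> \<not> {1,2,3} \<subseteq> f \<and> \<not> {0,3,4} \<subseteq> f"
    unfolding outer_tetrahedra_def by simp
  then show "\<not> {0,1,2} \<subseteq> f" "\<not> {1,2,3} \<subseteq> f" "\<not> {0,3,4} \<subseteq> f" using assms by blast+
qed

lemma rigid_core: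
  "rigid 3 (insert {0,1,2,3} (insert {0,1,2,4} (insert {1,2,3,4} outer_tetrahedra)))"
  unfolding rigid_def outer_tetrahedra_def by (simp add: insert_Diff_if)

text \<open>
  A face of the 4-simplex with at least four vertices omits at most one vertex. To avoid both 012 and
  123 it must omit one of 1 and 2.
\<close>

lemma large_face_of_simplex:
  assumes "x \<subseteq> {0,1,2,3,4::nat}" "3 < card x" "\<not> {0,1,2} \<subseteq> x" "\<not> {1,2,3} \<subseteq> x"
  shows "x = {0,1,3,4} \<or> x = {0,2,3,4}"
proof -
  let ?V = "{0,1,2,3,4::nat}"
  have unique: "u = w" if "u \<in> ?V" "w \<in> ?V" "u \<notin> x" "w \<notin> x" for u w
  proof (rule ccontr)
    assume "u \<noteq> w"
    have "card x \<le> card (?V - {u, w})" using assms(1) that by (intro card_mono) auto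
    also have "\<dots> = card ?V - card {u, w}" using that by (intro card_Diff_subset) simp_all
    also have "\<dots> = 3" using \<open>u \<noteq> w\<close> by simp
    finally show False using assms(2) by simp
  qed
  obtain u w where uw: "u \<in> {0,1,2}" "u \<notin> x" "w \<in> {1,2,3}" "w \<notin> x"
    using assms(3,4) by blast
  then have "u = w" by (intro unique) auto
  then have "u = 1 \<or> u = 2" using uw by auto
  moreover have "x = ?V - {u}"
  proof
    show "x \<subseteq> ?V - {u}" using assms(1) uw(2) unfolding subset_Diff_insert Diff_empty by (rule conjI)
    have "u \<in> ?V" using uw(1) by auto
    show "?V - {u} \<subseteq> x"
    proof
      fix z assume z: "z \<in> ?V - {u}"
      show "z \<in> x"
      proof (rule ccontr)
        assume "z \<notin> x"
        with z have "u = z" by (intro unique[OF \<open>u \<in> ?V\<close> _ uw(2)]) simp_all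
        with z show False by simp
      qed
    qed
  qed
  ultimately show ?thesis by (elim disjE) (simp_all add: insert_Diff_if)
qed

lemma simplicial_complex_generated:
  assumes "finite F" "\<And>f. f \<in> F \<Longrightarrow> finite f"
  shows "simplicial_complex {x. \<exists>f\<in>F. x \<subseteq> f}"
proof -
  have "{x. \<exists>f\<in>F. x \<subseteq> f} = (\<Union>f\<in>F. Pow f)" by auto
  then have "finite {x. \<exists>f\<in>F. x \<subseteq> f}" using assms by simp
  moreover have "finite x" if "x \<in> {x. \<exists>f\<in>F. x \<subseteq> f}" for x
    using that assms(2) finite_subset by auto
  moreover have "y \<in> {x. \<exists>f\<in>F. x \<subseteq> f}" if "x \<in> {x. \<exists>f\<in>F. x \<subseteq> f}" "y \<subseteq> x" for x y
  proof -
    from that(1) have "\<exists>f\<in>F. x \<subseteq> f" by simp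
    then obtain f where "f \<in> F" "x \<subseteq> f" ..
    moreover from this have "y \<subseteq> f" using that(2) by simp
    ultimately show ?thesis by auto
  qed
  ultimately show ?thesis unfolding simplicial_complex_def by (intro conjI ballI allI impI)
qed

lemma simplicial_complex_trap_complex: "simplicial_complex trap_complex"
  unfolding trap_complex_def
proof (rule simplicial_complex_generated)
  show "finite (insert {0,1,2,3,4} outer_tetrahedra)" by (simp add: outer_tetrahedra_def)
  show "finite f" if "f \<in> insert {0,1,2,3,4} outer_tetrahedra" for f
  proof (cases "f \<in> outer_tetrahedra")
    case True
    then have "card f = 4" by (rule card_outer_tetrahedra)
    then show ?thesis using card.infinite by fastforce
  next
    case False
    then have "f = {0,1,2,3,4}" using that by blast
    then show ?thesis by simp
  qed
qed

lemma free_face_trap_complex: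
  assumes "s \<subseteq> {0,1,2,3,4}" "\<And>f. f \<in> outer_tetrahedra \<Longrightarrow> \<not> s \<subseteq> f"
  shows "free_face trap_complex s {0,1,2,3,4}"
proof (rule free_faceI[OF _ assms(1)])
  show "{0,1,2,3,4} \<in> trap_complex" unfolding trap_complex_def by blast
  show "x \<subseteq> {0,1,2,3,4}" if "x \<in> trap_complex" "s \<subseteq> x" for x
    using that assms(2) unfolding trap_complex_def by blast
qed

text \<open>
  After the triangles 012 and 123 have been collapsed, the large faces are those of the peeling order.
  The second collapse is possible because 012 has only the vertex 0 outside 123.
\<close>

lemma d_collapsible_trap_complex: "d_collapsible (int 3) trap_complex"
proof -
  note sc = simplicial_complex_trap_complex
  have free: "free_face trap_complex {0,1,2} {0,1,2,3,4}" "free_face trap_complex {1,2,3} {0,1,2,3,4}"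
    using outer_tetrahedra_avoid by (intro free_face_trap_complex; simp)+
  let ?M = "deletion trap_complex {{0,1,2}}"
  let ?N = "deletion ?M {{1,2,3}}"
  have "{0,1,2} - {1,2,3} = {0::nat}" by auto
  then have free': "free_face ?M {1,2,3} ({0,1,2,3,4} - ({0,1,2} - {1,2,3}))"
    by (intro free_face_deletion_neighbour sc free) simp_all
  have "x \<in> ?N \<and> 3 < card x \<longleftrightarrow> x \<in> fst ` set peeling_order" for x
  proof
    assume "x \<in> ?N \<and> 3 < card x"
    then have x: "x \<in> trap_complex" "3 < card x" "\<not> {0,1,2} \<subseteq> x" "\<not> {1,2,3} \<subseteq> x"
      unfolding mem_deletion by blast+
    from x(1) consider "x \<subseteq> {0,1,2,3,4}" | f where "f \<in> outer_tetrahedra" "x \<subseteq> f"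
      unfolding trap_complex_def by blast
    then show "x \<in> fst ` set peeling_order"
    proof cases
      case 1
      then show ?thesis using large_face_of_simplex x(2-4) unfolding set_peeling_order by blast
    next
      case 2
      have card_f: "card f = 4" by (rule card_outer_tetrahedra[OF 2(1)])
      then have "finite f" using card.infinite by fastforce
      then have "x = f" using 2(2) card_f x(2) by (intro card_seteq) simp_all
      then show ?thesis using 2(1) unfolding set_peeling_order by blast
    qed
  next
    assume "x \<in> fst ` set peeling_order"
    then consider "x = {0,1,3,4}" | "x = {0,2,3,4}" | "x \<in> outer_tetrahedra"
      unfolding set_peeling_order by blast
    then show "x \<in> ?N \<and> 3 < card x"
    proof cases
      case 3
      then have "x \<in> trap_complex" unfolding trap_complex_def by blast
      then show ?thesis using 3 outer_tetrahedra_avoid[OF 3] card_outer_tetrahedra[OF 3]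
        by (simp add: mem_deletion)
    qed (simp_all add: mem_deletion trap_complex_def)
  qed
  then have "{x \<in> ?N. 3 < card x} = fst ` set peeling_order" by blast
  from d_collapsible_if_peeling[OF _ peeling_peeling_order this]
  have "d_collapsible (int 3) ?N" using simplicial_complex_deletion sc by blast
  then have "d_collapsible (int 3) ?M"
    by (intro d_collapsible_step[OF simplicial_complex_deletion[OF sc] free']) simp_all
  then show ?thesis by (intro d_collapsible_step[OF sc free(1)]) simp_all
qed

text \<open>
  The wrong first step is the collapse of 034. It destroys the 4-simplex, so that no face has more
  than four vertices, and spares the rigid set.
\<close>

lemma greedy_trap_trap_complex: "greedy_trap 3 trap_complex (deletion trap_complex {{0,3,4}})"
  unfolding greedy_trap_def
proof (intro conjI ballI exI)
  note sc = simplicial_complex_trap_complex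
  have cases: thesis if x: "x \<in> trap_complex" and "x \<subseteq> {0,1,2,3,4} \<Longrightarrow> thesis"
    and "card x \<le> 4 \<Longrightarrow> thesis" for x thesis
  proof -
    from x consider "x \<subseteq> {0,1,2,3,4}" | f where "f \<in> outer_tetrahedra" "x \<subseteq> f"
      unfolding trap_complex_def by blast
    then show thesis
    proof cases
      case 2
      have card_f: "card f = 4" by (rule card_outer_tetrahedra[OF 2(1)])
      then have "finite f" using card.infinite by fastforce
      then have "card x \<le> card f" using 2(2) by (rule card_mono)
      then show thesis using that(3) card_f by simp
    qed (rule that(2))
  qed
  have card5: "card {0,1,2,3,4::nat} = 5" by simp
  show "card x \<le> 3 + 2" if "x \<in> trap_complex" for x
    by (rule cases[OF that]) (use card_mono[of "{0,1,2,3,4}" x] card5 in simp_all)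
  show "card x \<le> 3 + 1" if "x \<in> deletion trap_complex {{0,3,4}}" for x
  proof -
    have x: "x \<in> trap_complex" "\<not> {0,3,4} \<subseteq> x" using that by (simp_all add: mem_deletion)
    show ?thesis
    proof (rule cases[OF x(1)])
      assume "x \<subseteq> {0,1,2,3,4}"
      moreover have "x \<noteq> {0,1,2,3,4}" using x(2) by auto
      ultimately have "x \<subset> {0,1,2,3,4}" by (rule psubsetI)
      then have "card x < 5" using psubset_card_mono[of "{0,1,2,3,4}" x] card5 by simp
      then show ?thesis by simp
    qed simp
  qed
  have free: "free_face trap_complex {0,3,4} {0,1,2,3,4}"
    using outer_tetrahedra_avoid by (intro free_face_trap_complex) simp_all
  have "elementary_d_collapse (int 3) trap_complex (deletion trap_complex {{0,3,4}})"
    unfolding elementary_d_collapse_iff[OF sc]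
    by (intro exI[of _ "{0,3,4}"] exI[of _ "{0,1,2,3,4}"] conjI free) simp_all
  then show "d_collapses_to (int 3) trap_complex (deletion trap_complex {{0,3,4}})"
    unfolding d_collapses_to_def by (rule r_into_rtranclp)
  have "f \<in> deletion trap_complex {{0,3,4}}" if "f \<in> outer_tetrahedra" for f
    using that outer_tetrahedra_avoid(3)[OF that] unfolding mem_deletion trap_complex_def by blast
  then show "insert {0,1,2,3} (insert {0,1,2,4} (insert {1,2,3,4} outer_tetrahedra))
      \<subseteq> deletion trap_complex {{0,3,4}}"
    by (auto simp: mem_deletion trap_complex_def)
qed (fact simplicial_complex_trap_complex d_collapsible_trap_complex rigid_core)+

lemma ex_greedy_trap:
  assumes "3 \<le> n" shows "\<exists>(K :: nat set set) L. greedy_trap n K L"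
  using assms
proof (induction n rule: dec_induct)
  case base
  show ?case using greedy_trap_trap_complex by blast
next
  case (step n)
  then obtain K L :: "nat set set" where trap: "greedy_trap n K L" by blast
  then have "finite (\<Union>K)" by (simp add: greedy_trap_def simplicial_complex_def)
  then obtain p q where pq: "p \<notin> \<Union>K" "q \<notin> insert p (\<Union>K)"
    using ex_new_if_finite[OF infinite_UNIV_nat] finite_insert by metis
  then show ?case using greedy_trap_suspension[OF trap, of p q] by blast
qed

section \<open>The greedy threshold\<close>

theorem theorem1p2:
  shows "(\<forall>d::int. d \<le> 2 \<longrightarrow>
           (\<forall>(K :: 'a set set) \<sigma>.
              simplicial_complex K \<and> d_collapsible d K \<and> d_collapsible_face d K \<sigma>
              \<longrightarrow> good_face d K \<sigma>)) \<and>
         (\<forall>d::int. d \<ge> 3 \<longrightarrow>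
           (\<exists>(K :: nat set set) \<sigma>.
              simplicial_complex K \<and> d_collapsible d K \<and> bad_face d K \<sigma>))"
proof (intro conjI allI impI)
  fix d :: int and K :: "'a set set" and \<sigma>
  assume "d \<le> 2" and K: "simplicial_complex K \<and> d_collapsible d K \<and> d_collapsible_face d K \<sigma>"
  then obtain t where t: "free_face K \<sigma> t" "int (card \<sigma>) \<le> d"
    using collapsible_face_iff_free[of K \<sigma>]
    unfolding d_collapsible_face_def dim_face_def by auto
  have "d_collapsible d (deletion K {\<sigma>})"
    using \<open>d \<le> 2\<close> K t by (intro free_faces_good) simp_all
  then show "good_face d K \<sigma>"
    using K unfolding good_face_def collapse_at_free[OF t(1)] by simp
next
  fix d :: int
  assume "3 \<le> d"
  then obtain K L :: "nat set set" where "greedy_trap (nat d) K L"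
    using ex_greedy_trap[of "nat d"] by (auto simp: nat_le_iff le_nat_iff)
  from bad_face_if_greedy_trap[OF this]
  show "\<exists>(K :: nat set set) \<sigma>. simplicial_complex K \<and> d_collapsible d K \<and> bad_face d K \<sigma>"
    using \<open>3 \<le> d\<close> by simp
qed

end
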